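(* Let $\lambda>0$ and let $\Theta$ be a real random variable with exponential probability density $P_\Theta(\theta)=\lambda e^{-\lambda\theta}$ for $\theta\ge 0$ (and $0$ for $\theta<0$). Let $R(D)$ be the rate-distortion function of $\Theta$ (in bits) under the distortion measure $d(\theta,\hat\theta)=|\theta-\hat\theta|$, and let $D(R)$ be the corresponding distortion-rate function. Then for every $D>0$, $$R(D)\le\log_2\!\left(\frac{1}{\lambda D}+\frac{\lambda D}{\lambda D+1}\right).$$ Equivalently, for every rate $R>0$, $$D(R)\le\frac{1}{2\lambda}\left(\sqrt{1+\frac{4}{2^{R}-1}}-1\right).$$
   Context: For a real-valued random variable $\Theta$ and the distortion measure $d(\theta,\hat\theta)=|\theta-\hat\theta|$, the rate-distortion function is $$R(D)=\inf_{P_{\hat\Theta|\Theta}:\ \mathbb{E}[|\Theta-\hat\Theta|]\le D} I(\Theta;\hat\Theta),$$ where the infimum is over all conditional distributions $P_{\hat\Theta|\Theta}$ of a real-valued reconstruction $\hat\Theta$ given $\Theta$, and $I(\Theta;\hat\Theta)$ is the mutual information measured in bits (logarithms to base $2$). The distortion-rate function is $D(R)=\inf\{D: R(D)\le R\}$. (In the paper's application, $\Theta$ is the magnitude of a model parameter and $\hat\Theta$ its quantized version.) *)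

theory Defs
  imports "HOL-Probability.Probability"
begin

text \<open>
  Mutual information in bits, with values in \<^typ>\<open>ereal\<close>.  The library's real-valued
  \<^const>\<open>prob_space.mutual_information\<close> is a Bochner integral: it returns \<open>0\<close> when the entropy
  density is not integrable, and is meaningless when the joint law is not absolutely continuous
  with respect to the product of its marginals.  In both of these cases the mutual information
  is \<open>\<infinity>\<close> (the negative part of the entropy density is always integrable with respect to the
  joint law, so failure of integrability means that the integral is \<open>\<infinity>\<close>).
\<close>

definition mutual_information_bits ::
  "'a measure \<Rightarrow> 'b measure \<Rightarrow> 'c measure \<Rightarrow> ('a \<Rightarrow> 'b) \<Rightarrow> ('a \<Rightarrow> 'c) \<Rightarrow> ereal" where
  "mutual_information_bits M S T X Y =
    (let P = distr M S X \<Otimes>\<^sub>M distr M T Y;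
         Q = distr M (S \<Otimes>\<^sub>M T) (\<lambda>x. (X x, Y x))
     in if absolutely_continuous P Q \<and> integrable Q (entropy_density 2 P Q)
        then ereal (prob_space.mutual_information M 2 S T X Y)
        else \<infinity>)"

definition joint_law :: "real measure \<Rightarrow> (real \<Rightarrow> real measure) \<Rightarrow> (real \<times> real) measure" where
  "joint_law P K = P \<bind> (\<lambda>\<theta>. distr (K \<theta>) (borel \<Otimes>\<^sub>M borel) (\<lambda>t. (\<theta>, t)))"

text \<open>
  Under \<^term>\<open>joint_law P K\<close> the source is \<^const>\<open>fst\<close> and the reconstruction is \<^const>\<open>snd\<close>.
  The integrability condition says that the expected distortion is finite; without it the
  Bochner integral would be \<open>0\<close>.
\<close>

definition admissible_channels :: "real measure \<Rightarrow> real \<Rightarrow> (real \<Rightarrow> real measure) set" where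
  "admissible_channels P D =
    {K \<in> borel \<rightarrow>\<^sub>M prob_algebra borel.
       integrable (joint_law P K) (\<lambda>(\<theta>, t). \<bar>\<theta> - t\<bar>) \<and>
       (\<integral>(\<theta>, t). \<bar>\<theta> - t\<bar> \<partial>joint_law P K) \<le> D}"

definition rate_distortion :: "real measure \<Rightarrow> real \<Rightarrow> ereal" where
  "rate_distortion P D =
    (INF K \<in> admissible_channels P D.
       mutual_information_bits (joint_law P K) borel borel fst snd)"

definition distortion_rate :: "real measure \<Rightarrow> real \<Rightarrow> ereal" where
  "distortion_rate P R = Inf {ereal D | D. rate_distortion P D \<le> ereal R}"

end

theory Submission
  imports Defs
begin

text \<open>
  Test channel: reconstruct \<open>\<theta>\<close> as \<open>t = max 0 (\<theta> - s)\<close> with \<open>s\<close> an independent exponential variable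
  of rate \<open>d\<close>.  The error \<open>\<theta> - t = min \<theta> s\<close> is then exponential of rate \<open>l + d\<close> and independent of
  \<open>t\<close>, so the distortion is \<open>1 / (l + d)\<close> and the mutual information is the difference of two
  exponential entropies, \<open>log 2 ((l + d) / l)\<close>.  With \<open>x = l * D\<close>, the number
  \<open>B = 1 / x + x / (x + 1) = 1 + 1 / (x * (x + 1))\<close> exceeds both \<open>1 / x\<close> and \<open>1\<close>, so choosing \<open>d\<close> with
  \<open>(l + d) / l = B\<close> gives distortion at most \<open>D\<close> at rate \<open>log 2 B\<close>.
\<close>

section \<open>The test channel and exponential tail integrals\<close>

abbreviation exponential_law :: "real \<Rightarrow> real measure" where
  "exponential_law a \<equiv> density lborel (\<lambda>x. ennreal (exponential_density a x))"

definition backward_channel :: "real \<Rightarrow> real \<Rightarrow> real measure" where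
  "backward_channel d \<theta> = distr (exponential_law d) borel (\<lambda>s. max 0 (\<theta> - s))"

lemma exponential_tail:
  fixes a c :: real
  assumes "a > 0"
  shows "(\<integral>\<^sup>+x. ennreal (exp (- a * x)) * indicator {c..} x \<partial>lborel) = ennreal (exp (- a * c) / a)"
proof -
  have "((\<lambda>x. - exp (- a * x) / a) \<longlongrightarrow> 0) at_top"
    using assms by real_asymp
  then have "(\<integral>\<^sup>+x. ennreal (exp (- a * x)) * indicator {c..} x \<partial>lborel) =
      ennreal (0 - (- exp (- a * c) / a))"
    using assms by (intro nn_integral_FTC_atLeast) (auto intro!: derivative_eq_intros)
  then show ?thesis by simp
qed

text \<open>The channel output is an atom plus a density. On the event \<open>s >= \<theta>\<close>,
  of probability \<open>exp (- d * \<theta>)\<close>, the output is clipped to 0; on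
  \<open>s < \<theta>\<close> the reflection \<open>t = \<theta> - s\<close> carries the exponential
  density from \<open>{0..<\<theta>}\<close> to \<open>{0<..\<theta>}\<close>.\<close>

lemma nn_integral_backward_channel:
  assumes g[measurable]: "g \<in> borel_measurable borel" and d: "d > 0" and \<theta>: "\<theta> \<ge> 0"
  shows "(\<integral>\<^sup>+t. g t \<partial>backward_channel d \<theta>) =
    g 0 * ennreal (exp (- d * \<theta>)) +
    (\<integral>\<^sup>+t. g t * ennreal (d * exp (- d * (\<theta> - t))) * indicator {0<..\<theta>} t \<partial>lborel)"
proof -
  have "(\<integral>\<^sup>+t. g t \<partial>backward_channel d \<theta>) =
     (\<integral>\<^sup>+s. ennreal (exponential_density d s) * g (max 0 (\<theta> - s)) \<partial>lborel)"
    unfolding backward_channel_def by (simp add: nn_integral_distr nn_integral_density)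
  also have "\<dots> = (\<integral>\<^sup>+s. (g 0 * ennreal d) * (ennreal (exp (- d * s)) * indicator {\<theta>..} s) +
       g (\<theta> - s) * ennreal (d * exp (- d * s)) * indicator {0..<\<theta>} s \<partial>lborel)"
    using \<theta> d by (intro nn_integral_cong)
      (auto simp: exponential_density_def indicator_def ennreal_mult ac_simps max_def)
  also have "\<dots> = (\<integral>\<^sup>+s. (g 0 * ennreal d) * (ennreal (exp (- d * s)) * indicator {\<theta>..} s) \<partial>lborel) +
       (\<integral>\<^sup>+s. g (\<theta> - s) * ennreal (d * exp (- d * s)) * indicator {0..<\<theta>} s \<partial>lborel)"
    by (intro nn_integral_add) auto
  also have "(\<integral>\<^sup>+s. (g 0 * ennreal d) * (ennreal (exp (- d * s)) * indicator {\<theta>..} s) \<partial>lborel)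
      = (g 0 * ennreal d) * ennreal (exp (- d * \<theta>) / d)"
    using exponential_tail[OF d, of \<theta>] by (simp add: nn_integral_cmult)
  also have "\<dots> = g 0 * ennreal (exp (- d * \<theta>))"
    using d by (simp add: mult.assoc flip: ennreal_mult)
  also have "(\<integral>\<^sup>+s. g (\<theta> - s) * ennreal (d * exp (- d * s)) * indicator {0..<\<theta>} s \<partial>lborel) =
     (\<integral>\<^sup>+t. g t * ennreal (d * exp (- d * (\<theta> - t))) * indicator {0<..\<theta>} t \<partial>lborel)"
    by (subst nn_integral_real_affine[where c="-1" and t=\<theta>])
       (auto intro!: nn_integral_cong simp: indicator_def)
  finally show ?thesis .
qed

lemma backward_channel_measurable:
  assumes "d > 0"
  shows "backward_channel d \<in> borel \<rightarrow>\<^sub>M prob_algebra borel"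
proof -
  have "exponential_law d \<in> space (prob_algebra borel)"
    using prob_space_exponential_density[OF assms] by (simp add: space_prob_algebra)
  then show ?thesis
    unfolding backward_channel_def[abs_def]
    by (intro measurable_distr_prob_space2[where M=borel]) (auto simp: prob_space_exponential_density)
qed

section \<open>Joint laws built from a source and a kernel\<close>

lemma joint_law_kernel_measurable:
  assumes K: "K \<in> borel \<rightarrow>\<^sub>M prob_algebra borel"
  shows "(\<lambda>\<theta>. distr (K \<theta>) (borel \<Otimes>\<^sub>M borel) (\<lambda>t. (\<theta>, t))) \<in> borel \<rightarrow>\<^sub>M prob_algebra (borel \<Otimes>\<^sub>M borel)"
  using K by (intro measurable_distr_prob_space2[where M=borel]) auto

lemma
  assumes P: "prob_space P" "sets P = sets borel" and K: "K \<in> borel \<rightarrow>\<^sub>M prob_algebra borel"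
  shows prob_space_joint_law: "prob_space (joint_law P K)"
    and sets_joint_law: "sets (joint_law P K) = sets (borel \<Otimes>\<^sub>M borel)"
  unfolding joint_law_def
  using P joint_law_kernel_measurable[OF K]
  by (auto intro!: prob_space_bind'[where M=borel] sets_bind'[where M=borel] simp: space_prob_algebra)

text \<open>Disintegration: every later computation with a joint law becomes an iterated integral
  through this identity.\<close>

lemma nn_integral_joint_law:
  assumes P: "sets P = sets borel" and K: "K \<in> borel \<rightarrow>\<^sub>M prob_algebra borel"
    and g[measurable]: "g \<in> borel_measurable (borel \<Otimes>\<^sub>M borel)"
  shows "(\<integral>\<^sup>+z. g z \<partial>joint_law P K) = (\<integral>\<^sup>+\<theta>. \<integral>\<^sup>+t. g (\<theta>, t) \<partial>K \<theta> \<partial>P)"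
proof -
  have [measurable_cong]: "sets (K \<theta>) = sets borel" for \<theta>
    using measurable_space[OF K, of \<theta>] by (simp add: space_prob_algebra)
  have "(\<lambda>\<theta>. distr (K \<theta>) (borel \<Otimes>\<^sub>M borel) (\<lambda>t. (\<theta>, t))) \<in> P \<rightarrow>\<^sub>M subprob_algebra (borel \<Otimes>\<^sub>M borel)"
    using measurable_prob_algebraD[OF joint_law_kernel_measurable[OF K]] P
    by (simp cong: measurable_cong_sets)
  from nn_integral_bind[OF g this] show ?thesis
    unfolding joint_law_def by (simp add: nn_integral_distr)
qed

lemma distr_fst_joint_law:
  assumes P: "prob_space P" "sets P = sets borel" and K: "K \<in> borel \<rightarrow>\<^sub>M prob_algebra borel"
  shows "distr (joint_law P K) borel fst = P"
proof (rule measure_eqI)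
  note [measurable_cong] = sets_joint_law[OF P K]
  fix A assume "A \<in> sets (distr (joint_law P K) borel fst)"
  then have [measurable]: "A \<in> sets borel" by simp
  have prob: "prob_space (K \<theta>)" for \<theta>
    using measurable_space[OF K, of \<theta>] by (simp add: space_prob_algebra)
  have "emeasure (distr (joint_law P K) borel fst) A =
     (\<integral>\<^sup>+z. indicator A z \<partial>distr (joint_law P K) borel fst)"
    by simp
  also have "\<dots> = (\<integral>\<^sup>+z. indicator A (fst z) \<partial>joint_law P K)"
    by (subst nn_integral_distr) auto
  also have "\<dots> = (\<integral>\<^sup>+\<theta>. indicator A \<theta> \<partial>P)"
    using prob by (simp add: nn_integral_joint_law[OF P(2) K] prob_space.emeasure_space_1)
  finally show "emeasure (distr (joint_law P K) borel fst) A = emeasure P A"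
    using P(2) by simp
qed (simp add: P)

section \<open>Mutual information computed from an explicit density\<close>

text \<open>By uniqueness of Radon-Nikodym derivatives, any density \<open>f\<close> of the joint
  law with respect to the product of its marginals yields the entropy density almost everywhere.
  Integrability of \<open>h\<close> then selects the finite branch of
  \<open>mutual_information_bits\<close>. The separate function \<open>h\<close> allows
  \<open>log 2 (f z)\<close> to be simplified on the support of \<open>J\<close> alone.\<close>

lemma mutual_information_bits_density:
  fixes J :: "(real \<times> real) measure" and f h :: "real \<times> real \<Rightarrow> real"
  defines "P \<equiv> distr J borel fst \<Otimes>\<^sub>M distr J borel snd"
  assumes J: "prob_space J" "sets J = sets (borel \<Otimes>\<^sub>M borel)"
    and f[measurable]: "f \<in> borel_measurable (borel \<Otimes>\<^sub>M borel)" and f0: "\<And>z. f z \<ge> 0"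
    and eq: "density P (\<lambda>z. ennreal (f z)) = J"
    and h: "AE z in J. log 2 (f z) = h z" "integrable J h"
  shows "mutual_information_bits J borel borel fst snd = ereal (\<integral>z. h z \<partial>J)"
proof -
  interpret J: prob_space J by fact
  note [measurable_cong] = J(2)
  interpret X: prob_space "distr J borel fst" by (rule J.prob_space_distr) simp
  interpret Y: prob_space "distr J borel snd" by (rule J.prob_space_distr) simp
  interpret XY: pair_prob_space "distr J borel fst" "distr J borel snd" ..
  have sP[measurable_cong]: "sets P = sets (borel \<Otimes>\<^sub>M borel)"
    unfolding P_def by (intro sets_pair_measure_cong) auto
  have dJ: "distr J (borel \<Otimes>\<^sub>M borel) (\<lambda>z. (fst z, snd z)) = J"
    using distr_id2[OF J(2)[symmetric]] by simp
  have fP: "(\<lambda>z. ennreal (f z)) \<in> borel_measurable P" by measurable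
  have ac: "absolutely_continuous P J"
    unfolding eq[symmetric] by (rule absolutely_continuousI_density[OF fP])
  have "sigma_finite_measure P" unfolding P_def ..
  then have "AE z in P. ennreal (f z) = RN_deriv P J z"
    by (rule sigma_finite_measure.RN_deriv_unique[OF _ fP eq])
  \<comment> \<open>Uniqueness holds almost everywhere for the product measure; absolute continuity
    transfers it to the joint law, over which the entropy density is integrated.\<close>
  then have "AE z in J. ennreal (f z) = RN_deriv P J z"
    by (rule absolutely_continuous_AE[rotated 2]) (simp_all add: ac J(2) sP)
  with h(1) have ae: "AE z in J. entropy_density 2 P J z = h z"
    by eventually_elim (metis comp_apply enn2real_ennreal entropy_density_def f0)
  have m: "entropy_density 2 P J \<in> borel_measurable J"
    using measurable_entropy_density[of 2 P J] by (simp cong: measurable_cong_sets add: J(2) sP)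
  have mh: "h \<in> borel_measurable J" using h(2) by auto
  have int: "integrable J (entropy_density 2 P J)"
    using integrable_cong_AE[OF m mh ae] h(2) by simp
  show ?thesis
    using int ac integral_cong_AE[OF m mh ae]
    unfolding mutual_information_bits_def J.mutual_information_def KL_divergence_def Let_def
      P_def[symmetric] dJ by simp
qed


section \<open>Joint law and output law of the test channel\<close>

abbreviation backward_joint_law :: "real \<Rightarrow> real \<Rightarrow> (real \<times> real) measure" where
  "backward_joint_law l d \<equiv> joint_law (exponential_law l) (backward_channel d)"

lemma nn_integral_backward_joint_law:
  assumes g[measurable]: "g \<in> borel_measurable (borel \<Otimes>\<^sub>M borel)" and l: "l > 0" and d: "d > 0"
  shows "(\<integral>\<^sup>+z. g z \<partial>backward_joint_law l d) =
    (\<integral>\<^sup>+\<theta>. ennreal (exponential_density l \<theta>) * (g (\<theta>, 0) * ennreal (exp (- d * \<theta>)) +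
      (\<integral>\<^sup>+t. g (\<theta>, t) * ennreal (d * exp (- d * (\<theta> - t))) * indicator {0<..\<theta>} t \<partial>lborel)) \<partial>lborel)"
proof -
  note K = backward_channel_measurable[OF d]
  have m: "(\<lambda>\<theta>. \<integral>\<^sup>+t. g (\<theta>, t) \<partial>backward_channel d \<theta>) \<in> borel_measurable borel"
    by (rule nn_integral_measurable_subprob_algebra2[OF _ measurable_prob_algebraD[OF K]]) simp
  have "(\<integral>\<^sup>+z. g z \<partial>backward_joint_law l d) =
     (\<integral>\<^sup>+\<theta>. ennreal (exponential_density l \<theta>) * (\<integral>\<^sup>+t. g (\<theta>, t) \<partial>backward_channel d \<theta>) \<partial>lborel)"
    using m by (simp add: nn_integral_joint_law K nn_integral_density)
  also have "\<dots> = (\<integral>\<^sup>+\<theta>. ennreal (exponential_density l \<theta>) * (g (\<theta>, 0) * ennreal (exp (- d * \<theta>)) +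
      (\<integral>\<^sup>+t. g (\<theta>, t) * ennreal (d * exp (- d * (\<theta> - t))) * indicator {0<..\<theta>} t \<partial>lborel)) \<partial>lborel)"
  proof (intro nn_integral_cong)
    fix \<theta> :: real
    show "ennreal (exponential_density l \<theta>) * (\<integral>\<^sup>+t. g (\<theta>, t) \<partial>backward_channel d \<theta>) =
      ennreal (exponential_density l \<theta>) * (g (\<theta>, 0) * ennreal (exp (- d * \<theta>)) +
      (\<integral>\<^sup>+t. g (\<theta>, t) * ennreal (d * exp (- d * (\<theta> - t))) * indicator {0<..\<theta>} t \<partial>lborel))"
    \<comment> \<open>The kernel formula is available for nonnegative \<open>\<theta>\<close>; for
      negative \<open>\<theta>\<close> the source density vanishes.\<close>
    proof (cases "\<theta> \<ge> 0")
      case True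
      then show ?thesis
        using nn_integral_backward_channel[of "\<lambda>t. g (\<theta>, t)" d \<theta>] d by simp
    qed (simp add: exponential_density_def)
  qed
  finally show ?thesis .
qed

text \<open>The output is 0 with probability \<open>l / (l + d)\<close> and otherwise exponential of
  rate \<open>l\<close>. Both pieces are tail integrals of
  \<open>exp (- (l + d) * \<theta>)\<close>: over \<open>\<theta> >= 0\<close> for the atom and,
  after Fubini, over \<open>\<theta> >= t\<close> for the density at \<open>t\<close>, where the
  factor \<open>exp (d * t)\<close> reduces the result to a multiple of
  \<open>exp (- l * t)\<close>.\<close>

lemma nn_integral_backward_output:
  assumes h[measurable]: "h \<in> borel_measurable borel" and l: "l > 0" and d: "d > 0"
  shows "(\<integral>\<^sup>+t. h t \<partial>distr (backward_joint_law l d) borel snd) =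
    h 0 * ennreal (l / (l + d)) +
    (\<integral>\<^sup>+t. h t * ennreal (d * l / (l + d) * exp (- l * t)) * indicator {0<..} t \<partial>lborel)"
proof -
  have ld: "l + d > 0" using l d by simp
  have [measurable_cong]: "sets (backward_joint_law l d) = sets (borel \<Otimes>\<^sub>M borel)"
    by (intro sets_joint_law prob_space_exponential_density backward_channel_measurable l d) simp
  have "(\<integral>\<^sup>+t. h t \<partial>distr (backward_joint_law l d) borel snd) =
      (\<integral>\<^sup>+\<theta>. ennreal (exponential_density l \<theta>) * (h 0 * ennreal (exp (- d * \<theta>)) +
      (\<integral>\<^sup>+t. h t * ennreal (d * exp (- d * (\<theta> - t))) * indicator {0<..\<theta>} t \<partial>lborel)) \<partial>lborel)"
    by (simp add: nn_integral_distr nn_integral_backward_joint_law l d)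
  also have "\<dots> = (\<integral>\<^sup>+\<theta>. (h 0 * ennreal l) * (ennreal (exp (- (l + d) * \<theta>)) * indicator {0..} \<theta>) +
      (\<integral>\<^sup>+t. ennreal (exponential_density l \<theta>) *
        (h t * ennreal (d * exp (- d * (\<theta> - t))) * indicator {0<..\<theta>} t) \<partial>lborel) \<partial>lborel)"
  proof (intro nn_integral_cong)
    fix \<theta> :: real
    have "ennreal (exponential_density l \<theta>) * (h 0 * ennreal (exp (- d * \<theta>))) =
       (h 0 * ennreal l) * (ennreal (exp (- (l + d) * \<theta>)) * indicator {0..} \<theta>)"
    proof (cases "\<theta> \<ge> 0")
      case True
      have "exponential_density l \<theta> * exp (- d * \<theta>) = l * exp (- (l + d) * \<theta>)"
        using True by (simp add: exponential_density_def exp_add[symmetric] algebra_simps)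
      then have "ennreal (exponential_density l \<theta>) * ennreal (exp (- d * \<theta>)) =
          ennreal l * ennreal (exp (- (l + d) * \<theta>))"
        using l by (simp add: exponential_density_nonneg flip: ennreal_mult)
      with True show ?thesis by (simp add: ac_simps)
    qed (simp add: exponential_density_def)
    then show "ennreal (exponential_density l \<theta>) * (h 0 * ennreal (exp (- d * \<theta>)) +
      (\<integral>\<^sup>+t. h t * ennreal (d * exp (- d * (\<theta> - t))) * indicator {0<..\<theta>} t \<partial>lborel)) =
       (h 0 * ennreal l) * (ennreal (exp (- (l + d) * \<theta>)) * indicator {0..} \<theta>) +
      (\<integral>\<^sup>+t. ennreal (exponential_density l \<theta>) *
        (h t * ennreal (d * exp (- d * (\<theta> - t))) * indicator {0<..\<theta>} t) \<partial>lborel)"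
      by (simp only: distrib_left) (simp add: nn_integral_cmult)
  qed
  also have "\<dots> = (\<integral>\<^sup>+\<theta>. (h 0 * ennreal l) * (ennreal (exp (- (l + d) * \<theta>)) * indicator {0..} \<theta>) \<partial>lborel) +
      (\<integral>\<^sup>+\<theta>. \<integral>\<^sup>+t. ennreal (exponential_density l \<theta>) *
        (h t * ennreal (d * exp (- d * (\<theta> - t))) * indicator {0<..\<theta>} t) \<partial>lborel \<partial>lborel)"
    \<comment> \<open>The interval depends on \<open>\<theta>\<close>; unfolding it to a predicate
      exposes its joint measurability in \<open>\<theta>\<close> and \<open>t\<close>.\<close>
    unfolding greaterThanAtMost_def greaterThan_def atMost_def
    by (intro nn_integral_add) measurable
  also have "(\<integral>\<^sup>+\<theta>. (h 0 * ennreal l) * (ennreal (exp (- (l + d) * \<theta>)) * indicator {0..} \<theta>) \<partial>lborel) =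
      h 0 * ennreal (l / (l + d))"
    using exponential_tail[OF ld, of 0] l ld
    by (simp add: nn_integral_cmult mult.assoc flip: ennreal_mult)
  also have "(\<integral>\<^sup>+\<theta>. \<integral>\<^sup>+t. ennreal (exponential_density l \<theta>) *
        (h t * ennreal (d * exp (- d * (\<theta> - t))) * indicator {0<..\<theta>} t) \<partial>lborel \<partial>lborel) =
     (\<integral>\<^sup>+t. \<integral>\<^sup>+\<theta>. ennreal (exponential_density l \<theta>) *
        (h t * ennreal (d * exp (- d * (\<theta> - t))) * indicator {0<..\<theta>} t) \<partial>lborel \<partial>lborel)"
    unfolding greaterThanAtMost_def greaterThan_def atMost_def
    by (rule lborel_pair.Fubini') measurable
  also have "\<dots> = (\<integral>\<^sup>+t. h t * ennreal (d * l / (l + d) * exp (- l * t)) * indicator {0<..} t \<partial>lborel)"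
  proof (intro nn_integral_cong)
    fix t :: real
    show "(\<integral>\<^sup>+\<theta>. ennreal (exponential_density l \<theta>) *
        (h t * ennreal (d * exp (- d * (\<theta> - t))) * indicator {0<..\<theta>} t) \<partial>lborel) =
       h t * ennreal (d * l / (l + d) * exp (- l * t)) * indicator {0<..} t"
    proof (cases "t > 0")
      case True
      have "(\<integral>\<^sup>+\<theta>. ennreal (exponential_density l \<theta>) *
        (h t * ennreal (d * exp (- d * (\<theta> - t))) * indicator {0<..\<theta>} t) \<partial>lborel) =
        (\<integral>\<^sup>+\<theta>. (h t * ennreal (d * l * exp (d * t))) *
           (ennreal (exp (- (l + d) * \<theta>)) * indicator {t..} \<theta>) \<partial>lborel)"
      proof (intro nn_integral_cong)
        fix \<theta> :: real
        have "exponential_density l \<theta> * (d * exp (- d * (\<theta> - t))) =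
            (d * l * exp (d * t)) * exp (- (l + d) * \<theta>)" if "t \<le> \<theta>"
          using True that by (simp add: exponential_density_def exp_add[symmetric] algebra_simps)
        then have "ennreal (exponential_density l \<theta>) * ennreal (d * exp (- d * (\<theta> - t))) =
            ennreal (d * l * exp (d * t)) * ennreal (exp (- (l + d) * \<theta>))" if "t \<le> \<theta>"
          using that l d by (simp add: exponential_density_nonneg flip: ennreal_mult)
        with True show "ennreal (exponential_density l \<theta>) *
           (h t * ennreal (d * exp (- d * (\<theta> - t))) * indicator {0<..\<theta>} t) =
           (h t * ennreal (d * l * exp (d * t))) *
           (ennreal (exp (- (l + d) * \<theta>)) * indicator {t..} \<theta>)"
          by (auto simp: indicator_def ac_simps)
      qed
      also have "\<dots> = (h t * ennreal (d * l * exp (d * t))) * ennreal (exp (- (l + d) * t) / (l + d))"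
        using exponential_tail[OF ld, of t] by (simp add: nn_integral_cmult)
      also have "\<dots> = h t * ennreal ((d * l * exp (d * t)) * (exp (- (l + d) * t) / (l + d)))"
        using l d by (subst ennreal_mult) (auto simp: mult.assoc)
      also have "(d * l * exp (d * t)) * (exp (- (l + d) * t) / (l + d)) = d * l / (l + d) * exp (- l * t)"
        by (simp add: exp_add[symmetric] algebra_simps)
      finally show ?thesis using True by simp
    qed simp
  qed
  finally show ?thesis .
qed

section \<open>The density of the joint law with respect to the product of its marginals\<close>

text \<open>
  The conditional density \<open>(l + d) * exp (- (l + d) * (\<theta> - t))\<close> of the source given the output,
  divided by the source density \<open>l * exp (- l * \<theta>)\<close>.
\<close>

definition likelihood_ratio :: "real \<Rightarrow> real \<Rightarrow> real \<times> real \<Rightarrow> real" where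
  "likelihood_ratio l d = (\<lambda>(\<theta>, t). if 0 \<le> t \<and> t \<le> \<theta>
     then (l + d) / l * exp (l * \<theta> - (l + d) * (\<theta> - t)) else 0)"

lemma likelihood_ratio_measurable[measurable]:
  "likelihood_ratio l d \<in> borel_measurable (borel \<Otimes>\<^sub>M borel)"
  unfolding likelihood_ratio_def split_beta' by measurable

lemma likelihood_ratio_nonneg: "l > 0 \<Longrightarrow> d > 0 \<Longrightarrow> likelihood_ratio l d z \<ge> 0"
  by (auto simp: likelihood_ratio_def split: prod.split)

text \<open>Bayes' rule, checked on the two pieces of the output law. For
  \<open>\<theta> >= 0\<close>, the ratio at \<open>t = 0\<close> times the atom
  \<open>l / (l + d)\<close> is the kernel's atom \<open>exp (- d * \<theta>)\<close>. For
  \<open>0 < t\<close> and \<open>t \<le> \<theta>\<close>, the ratio times the output density is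
  the kernel's density \<open>d * exp (- d * (\<theta> - t))\<close>.\<close>

lemma density_likelihood_ratio:
  fixes l d :: real
  defines "J \<equiv> backward_joint_law l d"
  assumes l: "l > 0" and d: "d > 0"
  shows "density (distr J borel fst \<Otimes>\<^sub>M distr J borel snd) (\<lambda>z. ennreal (likelihood_ratio l d z)) = J"
proof (rule measure_eqI)
  note P = prob_space_exponential_density[OF l]
  note K = backward_channel_measurable[OF d]
  have sJ[measurable_cong]: "sets J = sets (borel \<Otimes>\<^sub>M borel)"
    unfolding J_def by (intro sets_joint_law P K) simp
  interpret J: prob_space J
    unfolding J_def by (intro prob_space_joint_law P K) simp
  define Q where "Q = distr J borel snd"
  have fst_J: "distr J borel fst = exponential_law l"
    unfolding J_def by (intro distr_fst_joint_law P K) simp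
  have sQ[measurable_cong]: "sets Q = sets borel" by (simp add: Q_def)
  interpret Q: prob_space Q
    unfolding Q_def by (rule J.prob_space_distr) simp
  show "sets (density (distr J borel fst \<Otimes>\<^sub>M distr J borel snd) (\<lambda>z. ennreal (likelihood_ratio l d z))) = sets J"
    by (simp add: sJ cong: sets_pair_measure_cong)
  have sPQ: "sets (exponential_law l \<Otimes>\<^sub>M Q) = sets (borel \<Otimes>\<^sub>M borel)"
    by (intro sets_pair_measure_cong) (auto simp: sQ)
  fix A assume "A \<in> sets (density (distr J borel fst \<Otimes>\<^sub>M distr J borel snd) (\<lambda>z. ennreal (likelihood_ratio l d z)))"
  then have A[measurable]: "A \<in> sets (borel \<Otimes>\<^sub>M borel)"
    unfolding fst_J Q_def[symmetric] sets_density sPQ .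
  let ?r = "\<lambda>\<theta> t. ennreal (likelihood_ratio l d (\<theta>, t)) * indicator A (\<theta>, t)"
  have "emeasure (density (exponential_law l \<Otimes>\<^sub>M Q) (\<lambda>z. ennreal (likelihood_ratio l d z))) A =
     (\<integral>\<^sup>+\<theta>. \<integral>\<^sup>+t. ?r \<theta> t \<partial>Q \<partial>exponential_law l)"
    by (subst emeasure_density) (auto simp: Q.nn_integral_fst[symmetric] sPQ)
  also have "\<dots> = (\<integral>\<^sup>+\<theta>. ennreal (exponential_density l \<theta>) * (\<integral>\<^sup>+t. ?r \<theta> t \<partial>Q) \<partial>lborel)"
    by (intro nn_integral_density) measurable
  also have "\<dots> = (\<integral>\<^sup>+\<theta>. ennreal (exponential_density l \<theta>) * (indicator A (\<theta>, 0) * ennreal (exp (- d * \<theta>)) +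
      (\<integral>\<^sup>+t. indicator A (\<theta>, t) * ennreal (d * exp (- d * (\<theta> - t))) * indicator {0<..\<theta>} t \<partial>lborel)) \<partial>lborel)"
  proof (intro nn_integral_cong)
    fix \<theta> :: real
    show "ennreal (exponential_density l \<theta>) * (\<integral>\<^sup>+t. ?r \<theta> t \<partial>Q) =
      ennreal (exponential_density l \<theta>) * (indicator A (\<theta>, 0) * ennreal (exp (- d * \<theta>)) +
      (\<integral>\<^sup>+t. indicator A (\<theta>, t) * ennreal (d * exp (- d * (\<theta> - t))) * indicator {0<..\<theta>} t \<partial>lborel))"
    proof (cases "\<theta> \<ge> 0")
      case True
      have "(\<integral>\<^sup>+t. ?r \<theta> t \<partial>Q) = ?r \<theta> 0 * ennreal (l / (l + d)) +
         (\<integral>\<^sup>+t. ?r \<theta> t * ennreal (d * l / (l + d) * exp (- l * t)) * indicator {0<..} t \<partial>lborel)"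
        unfolding Q_def J_def by (rule nn_integral_backward_output[OF _ l d]) measurable
      also have "?r \<theta> 0 * ennreal (l / (l + d)) = indicator A (\<theta>, 0) * ennreal (exp (- d * \<theta>))"
      proof -
        have "likelihood_ratio l d (\<theta>, 0) * (l / (l + d)) = exp (- d * \<theta>)"
          using True l d by (simp add: likelihood_ratio_def) (simp add: algebra_simps)
        then have "ennreal (likelihood_ratio l d (\<theta>, 0)) * ennreal (l / (l + d)) = ennreal (exp (- d * \<theta>))"
          using l d by (simp add: likelihood_ratio_nonneg flip: ennreal_mult)
        then show ?thesis by (simp add: ac_simps indicator_def)
      qed
      also have "(\<integral>\<^sup>+t. ?r \<theta> t * ennreal (d * l / (l + d) * exp (- l * t)) * indicator {0<..} t \<partial>lborel) =
         (\<integral>\<^sup>+t. indicator A (\<theta>, t) * ennreal (d * exp (- d * (\<theta> - t))) * indicator {0<..\<theta>} t \<partial>lborel)"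
      proof (intro nn_integral_cong)
        fix t :: real
        have "likelihood_ratio l d (\<theta>, t) * (d * l / (l + d) * exp (- l * t)) = d * exp (- d * (\<theta> - t))"
          if "0 < t" "t \<le> \<theta>"
        proof -
          have "exp (l * \<theta> - (l + d) * (\<theta> - t)) * exp (- l * t) = exp (- d * (\<theta> - t))"
            by (simp add: exp_add[symmetric] algebra_simps)
          then show ?thesis
            using that l d by (simp add: likelihood_ratio_def)
        qed
        then have "ennreal (likelihood_ratio l d (\<theta>, t)) * ennreal (d * l / (l + d) * exp (- l * t)) =
            ennreal (d * exp (- d * (\<theta> - t)))" if "0 < t" "t \<le> \<theta>"
          using that l d by (simp add: likelihood_ratio_nonneg flip: ennreal_mult)
        moreover have "likelihood_ratio l d (\<theta>, t) = 0" if "t > \<theta>"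
          using that by (simp add: likelihood_ratio_def)
        ultimately show "?r \<theta> t * ennreal (d * l / (l + d) * exp (- l * t)) * indicator {0<..} t =
          indicator A (\<theta>, t) * ennreal (d * exp (- d * (\<theta> - t))) * indicator {0<..\<theta>} t"
          by (auto simp: indicator_def not_le)
      qed
      finally show ?thesis by simp
    qed (simp add: exponential_density_def)
  qed
  also have "\<dots> = (\<integral>\<^sup>+z. indicator A z \<partial>J)"
    unfolding J_def by (subst nn_integral_backward_joint_law) (auto simp: l d)
  also have "\<dots> = emeasure J A"
    by (simp add: sJ)
  finally show "emeasure (density (distr J borel fst \<Otimes>\<^sub>M distr J borel snd)
      (\<lambda>z. ennreal (likelihood_ratio l d z))) A = emeasure J A"
    unfolding fst_J Q_def .
qed


section \<open>Distortion and rate of the test channel\<close>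

text \<open>Given \<open>\<theta>\<close>, the error \<open>min \<theta> s\<close> has mean
  \<open>(1 - exp (- d * \<theta>)) / d\<close>. Averaging over the source gives
  \<open>(1 - l / (l + d)) / d = 1 / (l + d)\<close>.\<close>

lemma backward_channel_distortion:
  assumes l: "l > 0" and d: "d > 0"
  shows "(\<integral>\<^sup>+z. ennreal \<bar>fst z - snd z\<bar> \<partial>backward_joint_law l d) = ennreal (1 / (l + d))"
proof -
  \<comment> \<open>The first summand is the clipped case, where the reconstruction is 0 and the
    error is \<open>\<theta>\<close> itself.\<close>
  have inner: "ennreal \<theta> * ennreal (exp (- d * \<theta>)) +
      (\<integral>\<^sup>+t. ennreal \<bar>\<theta> - t\<bar> * ennreal (d * exp (- d * (\<theta> - t))) * indicator {0<..\<theta>} t \<partial>lborel) =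
      ennreal ((1 - exp (- d * \<theta>)) / d)" if \<theta>: "\<theta> \<ge> 0" for \<theta>
  proof -
    \<comment> \<open>Adding the null point \<open>t = 0\<close> closes the interval, as the
      fundamental theorem of calculus requires.\<close>
    have "(\<integral>\<^sup>+t. ennreal \<bar>\<theta> - t\<bar> * ennreal (d * exp (- d * (\<theta> - t))) * indicator {0<..\<theta>} t \<partial>lborel) =
      (\<integral>\<^sup>+t. ennreal ((\<theta> - t) * (d * exp (- d * (\<theta> - t)))) * indicator {0..\<theta>} t \<partial>lborel)"
      by (intro nn_integral_cong_AE, rule AE_mp[OF AE_lborel_singleton[of 0]], intro AE_I2)
        (use d in \<open>auto simp: indicator_def simp flip: ennreal_mult\<close>)
    also have "\<dots> = ennreal ((\<theta> - \<theta> + 1 / d) * exp (- d * (\<theta> - \<theta>)) - (\<theta> - 0 + 1 / d) * exp (- d * (\<theta> - 0)))"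
      using \<theta> d
      by (intro nn_integral_FTC_Icc[where F="\<lambda>t. (\<theta> - t + 1 / d) * exp (- d * (\<theta> - t))"])
         (auto intro!: derivative_eq_intros simp: field_simps has_real_derivative_iff_has_vector_derivative[symmetric])
    finally have eq: "(\<integral>\<^sup>+t. ennreal \<bar>\<theta> - t\<bar> * ennreal (d * exp (- d * (\<theta> - t))) * indicator {0<..\<theta>} t \<partial>lborel) =
        ennreal (1 / d - (\<theta> + 1 / d) * exp (- d * \<theta>))"
      by simp
    \<comment> \<open>This makes the integral's value a nonnegative real, so that
      \<open>ennreal\<close>, which truncates negative numbers to 0, commutes with the addition of
      the atom's contribution.\<close>
    have "(\<theta> + 1 / d) * exp (- d * \<theta>) \<le> 1 / d"
    proof -
      have "1 + d * \<theta> \<le> exp (d * \<theta>)" by (rule exp_ge_add_one_self)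
      then have "(1 + d * \<theta>) * exp (- (d * \<theta>)) \<le> exp (d * \<theta>) * exp (- (d * \<theta>))"
        by (intro mult_right_mono) auto
      then have "(1 + d * \<theta>) * exp (- (d * \<theta>)) / d \<le> 1 / d"
        using d by (intro divide_right_mono) (auto simp flip: exp_add)
      moreover have "(\<theta> + 1 / d) * exp (- d * \<theta>) = (1 + d * \<theta>) * exp (- (d * \<theta>)) / d"
        using d by (simp add: field_simps)
      ultimately show ?thesis by simp
    qed
    then show ?thesis
      unfolding eq using \<theta> d
      by (simp add: algebra_simps diff_divide_distrib flip: ennreal_mult ennreal_plus)
  qed
  have "(\<integral>\<^sup>+z. ennreal \<bar>fst z - snd z\<bar> \<partial>backward_joint_law l d) =
    (\<integral>\<^sup>+\<theta>. ennreal (exponential_density l \<theta>) * (ennreal \<bar>\<theta>\<bar> * ennreal (exp (- d * \<theta>)) +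
      (\<integral>\<^sup>+t. ennreal \<bar>\<theta> - t\<bar> * ennreal (d * exp (- d * (\<theta> - t))) * indicator {0<..\<theta>} t \<partial>lborel)) \<partial>lborel)"
    by (subst nn_integral_backward_joint_law) (auto simp: l d)
  also have "\<dots> = (\<integral>\<^sup>+\<theta>. ennreal (l * exp (- l * \<theta>) * ((1 - exp (- d * \<theta>)) / d)) * indicator {0..} \<theta> \<partial>lborel)"
  proof (intro nn_integral_cong)
    fix \<theta> :: real
    show "ennreal (exponential_density l \<theta>) * (ennreal \<bar>\<theta>\<bar> * ennreal (exp (- d * \<theta>)) +
      (\<integral>\<^sup>+t. ennreal \<bar>\<theta> - t\<bar> * ennreal (d * exp (- d * (\<theta> - t))) * indicator {0<..\<theta>} t \<partial>lborel)) =
      ennreal (l * exp (- l * \<theta>) * ((1 - exp (- d * \<theta>)) / d)) * indicator {0..} \<theta>"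
    proof (cases "\<theta> \<ge> 0")
      case True
      then show ?thesis
        using inner[OF True] l d by (simp add: exponential_density_def ac_simps flip: ennreal_mult)
    qed (simp add: exponential_density_def)
  qed
  also have "\<dots> = ennreal (0 - (- exp (- l * 0) + l / (l + d) * exp (- (l + d) * 0)) / d)"
  proof (rule nn_integral_FTC_atLeast[where F="\<lambda>\<theta>. (- exp (- l * \<theta>) + l / (l + d) * exp (- (l + d) * \<theta>)) / d"])
    show "((\<lambda>\<theta>. (- exp (- l * \<theta>) + l / (l + d) * exp (- (l + d) * \<theta>)) / d) \<longlongrightarrow> 0) at_top"
    proof -
      have lim: "((\<lambda>x. exp (- a * x)) \<longlongrightarrow> 0) at_top" if "a > 0" for a :: real
        using that by real_asymp
      show ?thesis
        using tendsto_divide[OF tendsto_add[OF tendsto_minus[OF lim[OF l]]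
            tendsto_mult_left[OF lim[of "l + d"], of "l / (l + d)"]] tendsto_const[of d]] l d
        by simp
    qed
    fix x :: real
    assume "0 \<le> x"
    then show "0 \<le> l * exp (- l * x) * ((1 - exp (- d * x)) / d)"
      using l d by simp
    have "exp (- (l + d) * x) = exp (- l * x) * exp (- d * x)"
      by (simp add: exp_add[symmetric] algebra_simps)
    moreover have "((\<lambda>\<theta>. (- exp (- l * \<theta>) + l / (l + d) * exp (- (l + d) * \<theta>)) / d) has_real_derivative
       (l * exp (- l * x) - l * exp (- (l + d) * x)) / d) (at x)"
      using l d by (auto intro!: derivative_eq_intros) (simp add: divide_simps, simp add: algebra_simps)
    ultimately show "((\<lambda>\<theta>. (- exp (- l * \<theta>) + l / (l + d) * exp (- (l + d) * \<theta>)) / d) has_real_derivative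
       l * exp (- l * x) * ((1 - exp (- d * x)) / d)) (at x)"
      by (simp add: algebra_simps)
  qed measurable
  also have "0 - (- exp (- l * 0) + l / (l + d) * exp (- (l + d) * 0)) / d = 1 / (l + d)"
    using l d by (simp add: divide_simps)
  finally show ?thesis .
qed

text \<open>The log-likelihood ratio is affine in the source and the error. Its exponent has mean
  \<open>l * (1 / l) - (l + d) * (1 / (l + d)) = 0\<close>, so only the constant
  \<open>log 2 ((l + d) / l)\<close> survives as mutual information.\<close>

lemma rate_distortion_exponential_le:
  fixes l d :: real
  assumes l: "l > 0" and d: "d > 0" and D: "1 / (l + d) \<le> D"
  shows "rate_distortion (exponential_law l) D \<le> ereal (log 2 ((l + d) / l))"
proof -
  define J where "J = backward_joint_law l d"
  note P = prob_space_exponential_density[OF l]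
  note K = backward_channel_measurable[OF d]
  have sJ[measurable_cong]: "sets J = sets (borel \<Otimes>\<^sub>M borel)"
    unfolding J_def by (intro sets_joint_law P K) simp
  have pJ: "prob_space J"
    unfolding J_def by (intro prob_space_joint_law P K) simp
  then interpret J: prob_space J .
  have fst_J: "distr J borel fst = exponential_law l"
    unfolding J_def by (intro distr_fst_joint_law P K) simp
  have "has_bochner_integral J (\<lambda>z. \<bar>fst z - snd z\<bar>) (1 / (l + d))"
    using l d backward_channel_distortion[OF l d]
    by (intro has_bochner_integral_nn_integral) (auto simp: J_def[symmetric])
  then have N: "integrable J (\<lambda>z. \<bar>fst z - snd z\<bar>)" "(\<integral>z. \<bar>fst z - snd z\<bar> \<partial>J) = 1 / (l + d)"
    by (auto simp: has_bochner_integral_iff)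
  interpret P: prob_space "exponential_law l" by fact
  \<comment> \<open>Viewing the source as the identity variable under its own law gives access to
    the known exponential moments.\<close>
  have dP: "distributed (exponential_law l) lborel (\<lambda>x. x) (exponential_density l)"
    by (auto simp: distributed_def exponential_density_nonneg[OF l] distr_id2)
  have "integrable (exponential_law l) (\<lambda>x. x)"
    using P.erlang_ith_moment_integrable[OF l dP, of 1] by simp
  then have T1: "integrable J fst"
    unfolding fst_J[symmetric] by (subst (asm) integrable_distr_eq) auto
  have T2: "(\<integral>z. fst z \<partial>J) = 1 / l"
    using P.exponential_distributed_expectation[OF l dP]
    unfolding fst_J[symmetric] by (subst (asm) integral_distr) auto
  \<comment> \<open>The joint law has density \<open>likelihood_ratio l d\<close>, which vanishes
    off this region, so the region has full measure.\<close>
  have ae: "AE z in J. 0 \<le> snd z \<and> snd z \<le> fst z"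
  proof (subst density_likelihood_ratio[OF l d, folded J_def, symmetric], subst AE_density)
    show "AE z in distr J borel fst \<Otimes>\<^sub>M distr J borel snd.
       0 < ennreal (likelihood_ratio l d z) \<longrightarrow> 0 \<le> snd z \<and> snd z \<le> fst z"
      by (auto simp: likelihood_ratio_def split: if_splits)
  qed measurable
  \<comment> \<open>On the support \<open>fst z - snd z\<close> equals its absolute value; writing
    the latter lets the distortion integral be reused.\<close>
  let ?h = "\<lambda>z. log 2 ((l + d) / l) + (l * fst z - (l + d) * \<bar>fst z - snd z\<bar>) / ln 2"
  have "mutual_information_bits J borel borel fst snd = ereal (\<integral>z. ?h z \<partial>J)"
  proof (rule mutual_information_bits_density[OF pJ sJ likelihood_ratio_measurable])
    show "AE z in J. log 2 (likelihood_ratio l d z) = ?h z"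
    proof (rule AE_mp[OF ae], rule AE_I2, rule impI)
      fix z :: "real \<times> real"
      assume z: "0 \<le> snd z \<and> snd z \<le> fst z"
      then have "likelihood_ratio l d z = (l + d) / l * exp (l * fst z - (l + d) * \<bar>fst z - snd z\<bar>)"
        by (simp add: likelihood_ratio_def split_beta)
      moreover have "(l + d) / l > 0" using l d by simp
      ultimately show "log 2 (likelihood_ratio l d z) = ?h z"
        by (simp only: log_def ln_mult_pos exp_gt_zero ln_exp add_divide_distrib)
    qed
    show "integrable J ?h" using N T1 by simp
  qed (use l d density_likelihood_ratio[OF l d] in \<open>auto simp: J_def likelihood_ratio_nonneg\<close>)
  also have "(\<integral>z. ?h z \<partial>J) = log 2 ((l + d) / l)"
    using N T1 T2 l d by (simp add: J.prob_space)
  finally have mi: "mutual_information_bits J borel borel fst snd = ereal (log 2 ((l + d) / l))" .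
  have "backward_channel d \<in> admissible_channels (exponential_law l) D"
    using K N D by (simp add: admissible_channels_def J_def split_beta')
  then have "rate_distortion (exponential_law l) D \<le> mutual_information_bits J borel borel fst snd"
    unfolding rate_distortion_def J_def by (rule INF_lower)
  then show ?thesis by (simp add: mi)
qed

section \<open>The closed-form bounds\<close>

text \<open>Partial fractions: \<open>x / (x + 1) = 1 - 1 / (x + 1)\<close>. The right-hand side
  shows that the bound exceeds 1 and turns its inversion into a quadratic equation.\<close>

lemma rate_bound_eq:
  fixes x :: real
  assumes "x > 0"
  shows "1 / x + x / (x + 1) = 1 + 1 / (x * (x + 1))"
  using assms by (simp add: divide_simps) (simp add: algebra_simps)

theorem mainTheorem3:
  fixes M :: "'a measure" and \<Theta> :: "'a \<Rightarrow> real" and l :: real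
  assumes "prob_space M"
    and "l > 0"
    and "distributed M lborel \<Theta> (exponential_density l)"
  shows "(\<forall>D>0. rate_distortion (distr M borel \<Theta>) D
              \<le> ereal (log 2 (1 / (l * D) + l * D / (l * D + 1)))) \<and>
         (\<forall>R>0. distortion_rate (distr M borel \<Theta>) R
              \<le> ereal (1 / (2 * l) * (sqrt (1 + 4 / (2 powr R - 1)) - 1)))"
proof -
  note l = \<open>l > 0\<close>
  \<comment> \<open>The density hypothesis targets \<open>lborel\<close> and the statement
    \<open>borel\<close>; the two have the same measurable sets, so the laws agree.\<close>
  have "distr M borel \<Theta> = distr M lborel \<Theta>"
    by (rule distr_cong) auto
  also have "\<dots> = exponential_law l"
    using distributed_distr_eq_density[OF assms(3)] by simp
  finally have law: "distr M borel \<Theta> = exponential_law l" .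
  have rate: "rate_distortion (exponential_law l) D
      \<le> ereal (log 2 (1 / (l * D) + l * D / (l * D + 1)))" if D: "D > 0" for D
  proof -
    define x where "x = l * D"
    define B where "B = 1 / x + x / (x + 1)"
    have x: "x > 0" using l D by (simp add: x_def)
    have B: "B = 1 + 1 / (x * (x + 1))" using x by (simp add: B_def rate_bound_eq)
    then have "B > 1" using x by simp
    then have d: "l * (B - 1) > 0" using l by simp
    \<comment> \<open>With \<open>d = l * (B - 1)\<close> one has \<open>l + d = l * B\<close>, so
      this inequality is the distortion constraint \<open>1 / (l + d) \<le> D\<close>.\<close>
    have "1 / x \<le> B" using x by (simp add: B_def)
    then have "1 / (l + l * (B - 1)) \<le> D"
      using x l D \<open>B > 1\<close> by (simp add: x_def field_simps)
    from rate_distortion_exponential_le[OF l d this] show ?thesis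
      using l by (simp add: B_def x_def right_diff_distrib)
  qed
  have "distortion_rate (exponential_law l) R
      \<le> ereal (1 / (2 * l) * (sqrt (1 + 4 / (2 powr R - 1)) - 1))" if R: "R > 0" for R
  proof -
    define q where "q = 2 powr R - 1"
    have q: "q > 0" using R by (simp add: q_def)
    define s where "s = sqrt (1 + 4 / q)"
    have s1: "s > 1" using q by (simp add: s_def)
    have s2: "s\<^sup>2 = 1 + 4 / q" using q by (simp add: s_def)
    \<comment> \<open>The positive root of \<open>l * D * (l * D + 1) = 1 / q\<close>. There the
      rate bound is exactly \<open>log 2 (1 + q) = R\<close>, so this \<open>D\<close> belongs to
      the set whose infimum is \<open>distortion_rate\<close>.\<close>
    define D where "D = 1 / (2 * l) * (s - 1)"
    have D: "D > 0" using s1 l by (simp add: D_def)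
    have x: "l * D = (s - 1) / 2" using l by (simp add: D_def)
    have "(l * D) * (l * D + 1) = 1 / q"
      using s2 unfolding x by (simp add: field_simps power2_eq_square)
    moreover have "1 / (l * D) + l * D / (l * D + 1) = 1 + 1 / ((l * D) * (l * D + 1))"
      using l D by (intro rate_bound_eq) simp
    ultimately have "1 / (l * D) + l * D / (l * D + 1) = 2 powr R"
      by (simp add: q_def)
    then have "rate_distortion (exponential_law l) D \<le> ereal R"
      using rate[OF D] by simp
    then show ?thesis
      unfolding distortion_rate_def D_def s_def q_def by (intro Inf_lower) auto
  qed
  with rate show ?thesis by (simp add: law)
qed

end
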